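(* For any graph $D$ (loops allowed) and any integer $q\ge 2$, $$p_0[D,q] \le 1 - q^{-\tau(D)}.$$
   Context: Graphs are finite and directed: $D=(V,E)$ with $V=\{1,\dots,n\}$, $n\ge1$, $E\subseteq V^2$. A loop $(v,v)$ counts as a cycle of length one; cycles are directed. A feedback vertex set of $D$ is a set $I\subseteq V$ such that $D-I$ has no cycles; $\tau(D)$ is the minimum size of a feedback vertex set. For an integer $q\ge2$ let $[q]=\{0,\dots,q-1\}$. For $f=(f_1,\dots,f_n):[q]^n\to[q]^n$, the interaction graph $G(f)$ has vertex set $V$ and an arc $(u,v)$ if and only if there exist $x,y\in[q]^n$ differing only in coordinate $u$ with $f_v(x)\ne f_v(y)$. $\mathrm{F}[D,q]$ is the set of all $f:[q]^n\to[q]^n$ with $G(f)=D$, and $p_0[D,q]=|\{f\in\mathrm{F}[D,q] : f \text{ has no fixed point}\}|/|\mathrm{F}[D,q]|$. *)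

theory Defs
  imports Complex_Main "HOL-Library.FuncSet" "Graph_Theory.Graph_Theory"
begin

text \<open>
  A digraph without parallel arcs, loops allowed, is a \<open>pair_fin_digraph\<close>. The library's
  \<open>pre_digraph.cycle\<close> is a nonempty closed directed walk without repeated vertices; a single
  loop is such a walk.
\<close>

definition feedback_vertex_set :: "'v pair_pre_digraph \<Rightarrow> 'v set \<Rightarrow> bool" where
  "feedback_vertex_set D I \<longleftrightarrow>
     I \<subseteq> pverts D \<and>
     \<not> (\<exists>p. pre_digraph.cycle (induce_subgraph (with_proj D) (pverts D - I)) p)"

definition transversal_number :: "'v pair_pre_digraph \<Rightarrow> nat" where
  "transversal_number D = Min (card ` {I. feedback_vertex_set D I})"

text \<open>
  States over the vertex set \<open>V\<close>, and maps between states, are extensional functions, so that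
  equality of maps and of states is equality on the relevant domain, and counting is correct.
  The component \<open>f\<^sub>v(x)\<close> is \<open>f x v\<close>.
\<close>

definition states :: "'v set \<Rightarrow> nat \<Rightarrow> ('v \<Rightarrow> nat) set" where
  "states V q = V \<rightarrow>\<^sub>E {0..<q}"

definition interaction_graph ::
    "'v set \<Rightarrow> nat \<Rightarrow> (('v \<Rightarrow> nat) \<Rightarrow> ('v \<Rightarrow> nat)) \<Rightarrow> 'v pair_pre_digraph" where
  "interaction_graph V q f =
     \<lparr> pverts = V,
       parcs = {(u, v). u \<in> V \<and> v \<in> V \<and>
         (\<exists>x \<in> states V q. \<exists>y \<in> states V q.
            x u \<noteq> y u \<and> (\<forall>w \<in> V - {u}. x w = y w) \<and> f x v \<noteq> f y v)} \<rparr>"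

definition maps_on ::
    "'v pair_pre_digraph \<Rightarrow> nat \<Rightarrow> (('v \<Rightarrow> nat) \<Rightarrow> ('v \<Rightarrow> nat)) set" where
  "maps_on D q =
     {f \<in> states (pverts D) q \<rightarrow>\<^sub>E states (pverts D) q. interaction_graph (pverts D) q f = D}"

definition no_fixpoint_prob :: "'v pair_pre_digraph \<Rightarrow> nat \<Rightarrow> real" where
  "no_fixpoint_prob D q =
     real (card {f \<in> maps_on D q. \<not> (\<exists>x \<in> states (pverts D) q. f x = x)}) /
     real (card (maps_on D q))"

end

theory Submission
  imports Defs "HOL-Number_Theory.Cong"
begin

text \<open>
  Let \<open>I\<close> be a minimum feedback vertex set. Adding a vector \<open>a \<in> [q]\<^sup>I\<close> modulo \<open>q\<close> to the components
  \<open>f\<^sub>v\<close> with \<open>v \<in> I\<close> does not change the interaction graph. Since \<open>D - I\<close> is acyclic, the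
  equations \<open>f\<^sub>v(x) = x\<^sub>v\<close> for \<open>v \<notin> I\<close> can be solved starting from \<open>x = 0\<close> on \<open>I\<close>, and a suitable
  translation then makes \<open>x\<close> a fixed point. As there are \<open>q\<close> to the power \<open>\<tau>(D)\<close> translations, all
  injective, at least the corresponding fraction of the maps has a fixed point.
\<close>

section \<open>Feedback vertex sets and well-foundedness\<close>

lemma wf_arcs_of_no_cycle:
  assumes "pair_fin_digraph D" and "I \<subseteq> pverts D"
    and no_cycle: "\<not> (\<exists>p. pre_digraph.cycle (induce_subgraph (with_proj D) (pverts D - I)) p)"
  shows "wf (parcs D \<inter> (pverts D - I) \<times> (pverts D - I))"
proof -
  interpret D: pair_fin_digraph D by fact
  let ?H = "induce_subgraph (with_proj D) (pverts D - I)"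
  interpret H: wf_digraph ?H
    by (rule D.wellformed_induce_subgraph)
  have arcs: "arcs_ends ?H = parcs D \<inter> (pverts D - I) \<times> (pverts D - I)"
    by (auto simp: arcs_ends_def arc_to_ends_def)
  \<comment> \<open>The transitive closure only yields a closed walk, possibly with repeated
    vertices; every nonempty closed walk contains a cycle.\<close>
  have "acyclic (arcs_ends ?H)"
  proof (rule acyclicI, intro allI notI)
    fix u assume "(u, u) \<in> (arcs_ends ?H)\<^sup>+"
    then obtain p where "H.awalk u p u" "p \<noteq> []"
      by (auto simp: H.reachable1_awalk)
    then have "H.closed_w p" by (auto simp: H.closed_w_def)
    then show False using H.closed_w_imp_cycle no_cycle by blast
  qed
  moreover have "finite (arcs_ends ?H)"
    unfolding arcs using D.finite_arcs by auto
  ultimately show ?thesis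
    using finite_acyclic_wf arcs by metis
qed

text \<open>Deleting all vertices leaves no cycle, so \<open>Min\<close> is taken over a finite
  nonempty set and is therefore one of its elements.\<close>

lemma transversal_number_attained:
  assumes "finite (pverts D)"
  obtains I where "feedback_vertex_set D I" "card I = transversal_number D"
proof -
  have "feedback_vertex_set D (pverts D)"
    by (auto simp: feedback_vertex_set_def pre_digraph.cycle_def pre_digraph.awalk_def)
  moreover have "finite {I. feedback_vertex_set D I}"
    by (rule finite_subset[of _ "Pow (pverts D)"])
       (auto simp: feedback_vertex_set_def assms)
  ultimately have "transversal_number D \<in> card ` {I. feedback_vertex_set D I}"
    unfolding transversal_number_def by (intro Min_in) auto
  then show thesis using that by auto
qed

section \<open>States and the dependence of a component on its in-neighbours\<close>

lemma states_less:
  assumes "x \<in> states V q" "v \<in> V"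
  shows "x v < q"
  using assms by (auto simp: states_def)

lemma states_update:
  assumes "x \<in> states V q" "w \<in> V" "c < q"
  shows "x(w := c) \<in> states V q"
  using assms by (auto simp: states_def PiE_def extensional_def)

lemma arc_of_interaction_graphI:
  assumes "x \<in> states V q" "y \<in> states V q" "u \<in> V" "v \<in> V"
    and "x u \<noteq> y u" "\<forall>w \<in> V - {u}. x w = y w" "f x v \<noteq> f y v"
  shows "(u, v) \<in> parcs (interaction_graph V q f)"
proof -
  have "\<exists>x \<in> states V q. \<exists>y \<in> states V q.
      x u \<noteq> y u \<and> (\<forall>w \<in> V - {u}. x w = y w) \<and> f x v \<noteq> f y v"
    using assms(5-7) by (intro bexI[OF _ assms(1)] bexI[OF _ assms(2)] conjI)
  then show ?thesis
    using assms(3,4) by (simp only: interaction_graph_def pair_pre_digraph.simps) blast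
qed

text \<open>Arcs are defined by changes of a single coordinate, so \<open>x\<close> is turned into
  \<open>y\<close> one coordinate at a time. A step that changed \<open>f x v\<close> would produce
  an arc into \<open>v\<close> from a coordinate where \<open>x\<close> and \<open>y\<close>
  differ.\<close>

lemma component_eq_if_agree_on_in_neighbours:
  assumes "finite V" "v \<in> V" "x \<in> states V q" "y \<in> states V q"
    and "\<And>u. (u, v) \<in> parcs (interaction_graph V q f) \<Longrightarrow> x u = y u"
  shows "f x v = f y v"
proof -
  \<comment> \<open>\<open>W\<close> contains all coordinates where \<open>x\<close> may still
    differ from \<open>y\<close>; the induction varies \<open>x\<close> and keeps \<open>y\<close>
    fixed.\<close>
  have "f x v = f y v"
    if "finite W" "W \<subseteq> V" "\<forall>u \<in> V - W. x u = y u" "x \<in> states V q"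
      "\<And>u. (u, v) \<in> parcs (interaction_graph V q f) \<Longrightarrow> x u = y u" for W x
    using that
  proof (induction W arbitrary: x rule: finite_induct)
    case empty
    then have "x = y"
      using assms(4) unfolding states_def by (intro PiE_ext) auto
    then show ?case by simp
  next
    case (insert w W)
    let ?x = "x(w := y w)"
    have yw: "y w < q"
      using assms(4) insert.prems(1) by (auto simp: states_def)
    have x': "?x \<in> states V q"
      using insert.prems yw by (intro states_update) auto
    have "f x v = f ?x v"
    proof (cases "x w = y w")
      case True
      then show ?thesis by (metis fun_upd_triv)
    next
      case False
      then have no_arc: "(w, v) \<notin> parcs (interaction_graph V q f)"
        using insert.prems(4) by blast
      show ?thesis
      proof (rule ccontr)
        assume "f x v \<noteq> f ?x v"
        moreover have "x w \<noteq> ?x w" "\<forall>u \<in> V - {w}. x u = ?x u" "w \<in> V"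
          using False insert.prems(1) by auto
        ultimately have "(w, v) \<in> parcs (interaction_graph V q f)"
          using insert.prems(3) x' assms(2) unfolding interaction_graph_def
          by (simp del: fun_upd_apply) blast
        with no_arc show False ..
      qed
    qed
    also have "\<dots> = f y v"
      using insert.prems by (intro insert.IH[OF _ _ x']) auto
    finally show ?case .
  qed
  from this[of V x] show ?thesis using assms by auto
qed

section \<open>Solving the fixed-point equations outside a feedback vertex set\<close>

lemma interaction_graph_arcs_subset: "parcs (interaction_graph V q f) \<subseteq> V \<times> V"
  by (auto simp: interaction_graph_def)

lemma maps_on_funcset:
  assumes "f \<in> maps_on D q"
  shows "f \<in> states (pverts D) q \<rightarrow>\<^sub>E states (pverts D) q"
  using assms unfolding maps_on_def by blast

lemma maps_on_interaction_graph:
  assumes "f \<in> maps_on D q"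
  shows "interaction_graph (pverts D) q f = D"
  using assms unfolding maps_on_def by blast

text \<open>With the coordinates in \<open>I\<close> set to 0, the value at \<open>v\<close> depends
  only on the in-neighbours of \<open>v\<close> outside \<open>I\<close>. The arcs among vertices
  outside \<open>I\<close> are well-founded, so these values are defined by recursion.\<close>

lemma solve_outside_feedback_vertex_set:
  assumes D: "pair_fin_digraph D" and I: "feedback_vertex_set D I"
    and f: "f \<in> maps_on D q" and q: "q > 0"
  obtains x where "x \<in> states (pverts D) q" "\<forall>v \<in> pverts D - I. f x v = x v"
proof -
  interpret D: pair_fin_digraph D by fact
  define V where "V = pverts D"
  define R where "R = parcs D \<inter> (V - I) \<times> (V - I)"
  have wf: "wf R"
    using wf_arcs_of_no_cycle[OF D] I by (auto simp: R_def V_def feedback_vertex_set_def)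
  have fst: "f y \<in> states V q" if "y \<in> states V q" for y
    using maps_on_funcset[OF f] that by (auto simp: V_def)
  \<comment> \<open>The input for the recursion at \<open>v\<close>. The guard
    \<open>z w < q\<close> makes it a state for arbitrary \<open>z\<close>, before the recursive
    solution is known to be bounded by \<open>q\<close>.\<close>
  define preds where "preds = (\<lambda>z v. \<lambda>w\<in>V. if (w, v) \<in> R \<and> z w < q then z w else 0)"
  define z where "z = wfrec R (\<lambda>z v. f (preds z v) v)"
  have preds_states: "preds z v \<in> states V q" for z v
    using q by (auto simp: preds_def states_def)
  have z: "z v = f (preds z v) v" for v
  proof -
    have "z v = f (preds (cut z R v) v) v"
      unfolding z_def by (subst wfrec[OF wf]) (rule refl)
    \<comment> \<open>\<open>cut\<close> alters \<open>z\<close> only outside the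
      \<open>R\<close>-predecessors of \<open>v\<close>, where \<open>preds\<close> returns 0
      anyway.\<close>
    also have "preds (cut z R v) v = preds z v"
      by (auto simp: preds_def cut_def intro!: restrict_ext)
    finally show ?thesis .
  qed
  have z_less: "z v < q" if "v \<in> V" for v
  proof -
    have "f (preds z v) v < q"
      using fst[OF preds_states[of z v]] that by (auto simp: states_def)
    then show ?thesis by (subst z)
  qed
  define x where "x = (\<lambda>v\<in>V. if v \<in> I then 0 else z v)"
  have x: "x \<in> states V q"
    using q z_less by (auto simp: x_def states_def)
  have "f x v = x v" if v: "v \<in> V - I" for v
  proof -
    have "f x v = f (preds z v) v"
    proof (rule component_eq_if_agree_on_in_neighbours[OF _ _ x preds_states])
      fix u assume "(u, v) \<in> parcs (interaction_graph V q f)"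
      then have uv: "(u, v) \<in> parcs D" "u \<in> V"
        using maps_on_interaction_graph[OF f] interaction_graph_arcs_subset[of V q f]
        by (auto simp: V_def)
      \<comment> \<open>For \<open>u\<close> in \<open>I\<close> both sides are the default 0;
        otherwise \<open>(u, v)\<close> lies in \<open>R\<close>, the guard holds, and both sides
        are \<open>z u\<close>.\<close>
      then show "x u = preds z v u"
        using v z_less[of u] by (auto simp: x_def preds_def R_def)
    qed (use v in \<open>auto simp: V_def\<close>)
    with v show ?thesis using z[of v] by (simp add: x_def)
  qed
  with x that show thesis unfolding V_def by blast
qed

section \<open>Translations modulo \<open>q\<close>\<close>

definition translate ::
    "'v set \<Rightarrow> 'v set \<Rightarrow> nat \<Rightarrow> ('v \<Rightarrow> nat) \<Rightarrow> (('v \<Rightarrow> nat) \<Rightarrow> ('v \<Rightarrow> nat)) \<Rightarrow> (('v \<Rightarrow> nat) \<Rightarrow> ('v \<Rightarrow> nat))"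
  where "translate V I q a f =
    (\<lambda>x \<in> states V q. \<lambda>v\<in>V. if v \<in> I then (f x v + a v) mod q else f x v)"

lemma add_mod_cancel_nat:
  fixes a b c q :: nat
  assumes "(b + a) mod q = (c + a) mod q" "b < q" "c < q"
  shows "b = c"
  using assms cong_add_rcancel_nat[of b a c q] by (simp add: cong_def)

text \<open>At a fixed \<open>v\<close> the translation applies one injective map of [q] to the
  component. Two maps and two states are allowed so as to cover both uses: \<open>f = g\<close> for
  the interaction graph, \<open>x = y\<close> for injectivity of the translation.\<close>

lemma translate_component_eq_iff:
  assumes "f \<in> states V q \<rightarrow> states V q" "g \<in> states V q \<rightarrow> states V q"
    and "x \<in> states V q" "y \<in> states V q" "v \<in> V"
  shows "translate V I q a f x v = translate V I q a g y v \<longleftrightarrow> f x v = g y v"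
proof -
  have "f x v < q" "g y v < q"
    using states_less[OF funcset_mem[OF assms(1,3)] assms(5)]
      states_less[OF funcset_mem[OF assms(2,4)] assms(5)] .
  then show ?thesis
    using assms(3-5) by (auto simp: translate_def dest: add_mod_cancel_nat)
qed

lemma translate_in_maps_on:
  assumes f: "f \<in> maps_on D q" and q: "q > 0"
  shows "translate (pverts D) I q a f \<in> maps_on D q"
proof -
  define V where "V = pverts D"
  have fst: "f \<in> states V q \<rightarrow> states V q"
    using maps_on_funcset[OF f] by (auto simp: V_def)
  have "translate V I q a f \<in> states V q \<rightarrow>\<^sub>E states V q"
  proof (rule PiE_I)
    fix x assume x: "x \<in> states V q"
    have "f x v < q" if "v \<in> V" for v
      using states_less[OF funcset_mem[OF fst x] that] .
    with x q show "translate V I q a f x \<in> states V q"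
      by (simp add: translate_def states_def)
  qed (simp add: translate_def)
  \<comment> \<open>The translation preserves whether a component differs between two states, which
    is all that the arcs record.\<close>
  moreover have "interaction_graph V q (translate V I q a f) = interaction_graph V q f"
    unfolding interaction_graph_def
    by (simp add: translate_component_eq_iff[OF fst fst] cong: conj_cong bex_cong)
  ultimately show ?thesis
    using maps_on_interaction_graph[OF f] by (simp add: maps_on_def V_def)
qed

lemma translate_inject:
  assumes f: "f \<in> maps_on D q" and g: "g \<in> maps_on D q"
    and eq: "translate (pverts D) I q a f = translate (pverts D) I q a g"
  shows "f = g"
proof -
  define V where "V = pverts D"
  have fg: "f \<in> states V q \<rightarrow>\<^sub>E states V q" "g \<in> states V q \<rightarrow>\<^sub>E states V q"
    using maps_on_funcset[OF f] maps_on_funcset[OF g] by (auto simp: V_def)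
  show ?thesis
  proof (rule PiE_ext[OF fg])
    fix x assume x: "x \<in> states V q"
    have "f x v = g x v" if "v \<in> V" for v
      using translate_component_eq_iff[of f V q g x x v I a] fg x that eq
      by (auto simp: V_def PiE_iff Pi_iff)
    moreover have "f x \<in> V \<rightarrow>\<^sub>E {0..<q}" "g x \<in> V \<rightarrow>\<^sub>E {0..<q}"
      using fg x by (auto simp: states_def)
    ultimately show "f x = g x" by (intro PiE_ext) auto
  qed
qed

text \<open>Take a state solving the equations outside \<open>I\<close>. The translation leaves
  those components alone, and on \<open>I\<close> each component can be shifted to the required
  value independently.\<close>

lemma exists_translate_with_fixpoint:
  assumes D: "pair_fin_digraph D" and I: "feedback_vertex_set D I"
    and f: "f \<in> maps_on D q" and q: "q > 0"
  shows "\<exists>a \<in> states I q. \<exists>x \<in> states (pverts D) q. translate (pverts D) I q a f x = x"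
proof -
  define V where "V = pverts D"
  obtain x where x: "x \<in> states V q" and sol: "\<forall>v \<in> V - I. f x v = x v"
    using solve_outside_feedback_vertex_set[OF D I f q] unfolding V_def by blast
  have fx: "f x v < q" if "v \<in> V" for v
    using states_less[OF PiE_mem[OF maps_on_funcset[OF f]]] x that by (simp add: V_def)
  \<comment> \<open>This is \<open>x v - f x v\<close> modulo \<open>q\<close>; adding
    \<open>q\<close> first avoids truncated subtraction.\<close>
  define a where "a = (\<lambda>v\<in>I. (x v + (q - f x v)) mod q)"
  have "a \<in> states I q"
    using q by (auto simp: a_def states_def)
  moreover have "translate V I q a f x = x"
  proof (rule PiE_ext)
    show "x \<in> V \<rightarrow>\<^sub>E UNIV" using x by (auto simp: states_def)
    show "translate V I q a f x \<in> V \<rightarrow>\<^sub>E UNIV" using x by (auto simp: translate_def)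
    fix v assume v: "v \<in> V"
    show "translate V I q a f x v = x v"
    proof (cases "v \<in> I")
      case True
      have "(f x v + a v) mod q = (f x v + (x v + (q - f x v))) mod q"
        using True by (simp add: a_def mod_add_right_eq)
      also have "f x v + (x v + (q - f x v)) = x v + q" using fx[OF v] by simp
      also have "(x v + q) mod q = x v" using states_less[OF x v] by simp
      finally show ?thesis using True v x by (simp add: translate_def)
    qed (use v x sol in \<open>auto simp: translate_def\<close>)
  qed
  ultimately show ?thesis using x unfolding V_def by blast
qed

section \<open>Counting\<close>

lemma card_states:
  assumes "finite V"
  shows "card (states V q) = q ^ card V"
  using assms by (simp add: states_def card_PiE)

lemma finite_maps_on:
  assumes "finite (pverts D)"
  shows "finite (maps_on D q)"
proof -
  have "finite (states (pverts D) q)"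
    using assms by (simp add: states_def finite_PiE)
  then have "finite (states (pverts D) q \<rightarrow>\<^sub>E states (pverts D) q)"
    by (simp add: finite_PiE)
  then show ?thesis
    by (rule rev_finite_subset) (use maps_on_funcset in blast)
qed

text \<open>Every map has a translate with a fixed point, so the maps are covered by the sets, one
  for each \<open>a\<close>, of maps whose translate by \<open>a\<close> has a fixed point.
  Translation by \<open>a\<close> injects each of these sets into the maps with a fixed point, and
  the union bound applies.\<close>

lemma card_maps_on_le:
  assumes D: "pair_fin_digraph D" and I: "feedback_vertex_set D I" and q: "q > 0"
  shows "card (maps_on D q) \<le>
    q ^ card I * card {f \<in> maps_on D q. \<exists>x \<in> states (pverts D) q. f x = x}"
proof -
  have finV: "finite (pverts D)"
    using D by (rule pair_fin_digraph.pair_finite_verts)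
  let ?T = "translate (pverts D) I q"
  let ?Fix = "{f \<in> maps_on D q. \<exists>x \<in> states (pverts D) q. f x = x}"
  have "finite I"
    using I finite_subset[OF _ finV] by (simp add: feedback_vertex_set_def)
  then have finA: "finite (states I q)" by (simp add: states_def finite_PiE)
  have finM: "finite (maps_on D q)" using finite_maps_on[OF finV] .
  have "maps_on D q \<subseteq> (\<Union>a \<in> states I q. {f \<in> maps_on D q. ?T a f \<in> ?Fix})"
  proof
    fix f assume f: "f \<in> maps_on D q"
    then obtain a where "a \<in> states I q" "\<exists>x \<in> states (pverts D) q. ?T a f x = x"
      using exists_translate_with_fixpoint[OF D I _ q] by blast
    with f translate_in_maps_on[OF f q]
    show "f \<in> (\<Union>a \<in> states I q. {f \<in> maps_on D q. ?T a f \<in> ?Fix})" by blast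
  qed
  then have "card (maps_on D q) \<le> card (\<Union>a \<in> states I q. {f \<in> maps_on D q. ?T a f \<in> ?Fix})"
    using finA finM by (intro card_mono) auto
  also have "\<dots> \<le> (\<Sum>a \<in> states I q. card {f \<in> maps_on D q. ?T a f \<in> ?Fix})"
    by (rule card_UN_le[OF finA])
  also have "\<dots> \<le> (\<Sum>a \<in> states I q. card ?Fix)"
  proof (rule sum_mono)
    fix a
    have "inj_on (?T a) {f \<in> maps_on D q. ?T a f \<in> ?Fix}"
      using translate_inject by (intro inj_onI) blast
    then show "card {f \<in> maps_on D q. ?T a f \<in> ?Fix} \<le> card ?Fix"
      using finM by (intro card_inj_on_le[of "?T a"]) auto
  qed
  finally show ?thesis using card_states[OF \<open>finite I\<close>] by simp
qed

theorem proposition4p3: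
  fixes D :: "nat pair_pre_digraph" and n q :: nat
  assumes "n \<ge> 1"
    and "pverts D = {1..n}"
    and "pair_fin_digraph D"
    and "q \<ge> 2"
  shows "no_fixpoint_prob D q \<le> 1 - real q powi (- int (transversal_number D))"
proof -
  let ?F = "maps_on D q"
  let ?Fix = "{f \<in> ?F. \<exists>x \<in> states (pverts D) q. f x = x}"
  let ?N = "{f \<in> ?F. \<not> (\<exists>x \<in> states (pverts D) q. f x = x)}"
  define Q where "Q = real q ^ transversal_number D"
  have Q: "Q \<ge> 1" using assms(4) by (simp add: Q_def)
  have Q_inv: "real q powi (- int (transversal_number D)) = 1 / Q"
    by (simp add: Q_def power_int_minus divide_inverse)
  have fin: "finite ?F" using finite_maps_on[of D q] assms(2) by simp
  obtain I where I: "feedback_vertex_set D I" "card I = transversal_number D"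
    using transversal_number_attained[of D] assms(2) by auto
  have "real (card ?F) \<le> real (q ^ card I * card ?Fix)"
    using card_maps_on_le[OF assms(3) I(1), of q] assms(4) of_nat_mono by fastforce
  then have le: "real (card ?F) \<le> Q * real (card ?Fix)"
    by (simp add: Q_def I(2))
  have "card ?F = card (?N \<union> ?Fix)" by (rule arg_cong[of _ _ card]) auto
  also have "\<dots> = card ?N + card ?Fix"
    using fin by (intro card_Un_disjoint) auto
  finally have split: "real (card ?F) = real (card ?N) + real (card ?Fix)" by simp
  show ?thesis
  \<comment> \<open>The empty case is settled by division by zero being 0 and \<open>Q\<close> \<ge>
    1, which spares a proof that some map has interaction graph \<open>D\<close>.\<close>
  proof (cases "card ?F = 0")
    case True
    then show ?thesis using Q by (simp add: no_fixpoint_prob_def Q_inv)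
  next
    case False
    have "real (card ?N) \<le> (1 - 1 / Q) * real (card ?F)"
      using le split Q by (simp add: field_simps)
    then show ?thesis
      using False unfolding no_fixpoint_prob_def Q_inv by (simp add: pos_divide_le_eq)
  qed
qed

end
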